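(* The logic ${\sf ITL}^0_{\Diamond\forall}$ is complete for the class of dynamical systems: every $\mathcal L_{\Diamond\forall}$-formula valid on all dynamical systems belongs to ${\sf ITL}^0_{\Diamond\forall}$.
   Context: Syntax: fix a countably infinite set $\mathbb P$ of propositional variables. $\mathcal L_{\Diamond\forall}$ is given by $\varphi ::= \bot \mid p \mid \varphi\wedge\varphi \mid \varphi\vee\varphi \mid \varphi\to\varphi \mid \circ\varphi \mid \Diamond\varphi \mid \forall\varphi$ with $p\in\mathbb P$; $\neg\varphi:=\varphi\to\bot$, $\varphi\leftrightarrow\psi:=(\varphi\to\psi)\wedge(\psi\to\varphi)$. Semantics: a dynamical system is $(X,\mathcal T,f)$ with $(X,\mathcal T)$ a topological space and $f\colon X\to X$ continuous. A valuation assigns to each formula an open set with $[\![\bot]\!]=\varnothing$, $[\![\varphi\wedge\psi]\!]=[\![\varphi]\!]\cap[\![\psi]\!]$, $[\![\varphi\vee\psi]\!]=[\![\varphi]\!]\cup[\![\psi]\!]$, $[\![\varphi\to\psi]\!]=\big((X\setminus[\![\varphi]\!])\cup[\![\psi]\!]\big)^\circ$, $[\![\circ\varphi]\!]=f^{-1}[\![\varphi]\!]$, $[\![\Diamond\varphi]\!]=\bigcup_{n<\omega}f^{-n}[\![\varphi]\!]$, $[\![\forall\varphi]\!]=X$ if $[\![\varphi]\!]=X$ and $\varnothing$ otherwise. Validity on a class: $[\![\varphi]\!]=X$ for every system in the class and every valuation. Logic: ${\sf ITL}^0_{\Diamond\forall}$ is the least set of $\mathcal L_{\Diamond\forall}$-formulas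 containing all substitution instances of the axioms of intuitionistic propositional logic and of (N1) $\neg\circ\bot$, (N2) $\circ\varphi\wedge\circ\psi\to\circ(\varphi\wedge\psi)$, (N3) $\circ(\varphi\vee\psi)\to\circ\varphi\vee\circ\psi$, (N4) $\circ(\varphi\to\psi)\to(\circ\varphi\to\circ\psi)$, (E1) $\varphi\vee\circ\Diamond\varphi\to\Diamond\varphi$, (UA1) $\forall\varphi\vee\neg\forall\varphi$, (UA2) $\forall(\varphi\to\psi)\to(\forall\varphi\to\forall\psi)$, (UA3) $\forall(\varphi\vee\forall\psi)\to\forall\varphi\vee\forall\psi$, (UA4) $\forall\varphi\to\varphi$, (UA5) $\forall\varphi\to\forall\forall\varphi$, (UA6) $\forall\varphi\leftrightarrow\circ\forall\varphi$, and closed under the rules: modus ponens; from $\varphi$ infer $\circ\varphi$; from $\varphi\to\psi$ infer $\Diamond\varphi\to\Diamond\psi$; from $\circ\varphi\to\varphi$ infer $\Diamond\varphi\to\varphi$; from $\varphi$ infer $\forall\varphi$. *)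

theory Defs
  imports "HOL-Analysis.Abstract_Topology"
begin

datatype fm =
    Bot
  | Var nat
  | And fm fm
  | Or fm fm
  | Imp fm fm
  | Nxt fm
  | Dia fm
  | Univ fm

definition Neg :: "fm \<Rightarrow> fm" where "Neg \<phi> = Imp \<phi> Bot"
definition Iff :: "fm \<Rightarrow> fm \<Rightarrow> fm" where "Iff \<phi> \<psi> = And (Imp \<phi> \<psi>) (Imp \<psi> \<phi>)"

definition dyn_system :: "'a topology \<Rightarrow> ('a \<Rightarrow> 'a) \<Rightarrow> bool" where
  "dyn_system T f \<longleftrightarrow> continuous_map T T f"

fun sem :: "'a topology \<Rightarrow> ('a \<Rightarrow> 'a) \<Rightarrow> (nat \<Rightarrow> 'a set) \<Rightarrow> fm \<Rightarrow> 'a set" where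
  "sem T f V Bot = {}"
| "sem T f V (Var p) = V p"
| "sem T f V (And \<phi> \<psi>) = sem T f V \<phi> \<inter> sem T f V \<psi>"
| "sem T f V (Or \<phi> \<psi>) = sem T f V \<phi> \<union> sem T f V \<psi>"
| "sem T f V (Imp \<phi> \<psi>) = T interior_of ((topspace T - sem T f V \<phi>) \<union> sem T f V \<psi>)"
| "sem T f V (Nxt \<phi>) = {x \<in> topspace T. f x \<in> sem T f V \<phi>}"
| "sem T f V (Dia \<phi>) = (\<Union>n. {x \<in> topspace T. (f ^^ n) x \<in> sem T f V \<phi>})"
| "sem T f V (Univ \<phi>) = (if sem T f V \<phi> = topspace T then topspace T else {})"

definition valuation :: "'a topology \<Rightarrow> (nat \<Rightarrow> 'a set) \<Rightarrow> bool" where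
  "valuation T V \<longleftrightarrow> (\<forall>p. openin T (V p))"

definition valid_dyn :: "'a itself \<Rightarrow> fm \<Rightarrow> bool" where
  "valid_dyn _ \<phi> \<longleftrightarrow>
     (\<forall>(T::'a topology) f V. dyn_system T f \<longrightarrow> valuation T V \<longrightarrow> sem T f V \<phi> = topspace T)"

inductive ITL0 :: "fm \<Rightarrow> bool" where
  IPC1: "ITL0 (Imp \<phi> (Imp \<psi> \<phi>))"
| IPC2: "ITL0 (Imp (Imp \<phi> (Imp \<psi> \<chi>)) (Imp (Imp \<phi> \<psi>) (Imp \<phi> \<chi>)))"
| IPC3: "ITL0 (Imp (And \<phi> \<psi>) \<phi>)"
| IPC4: "ITL0 (Imp (And \<phi> \<psi>) \<psi>)"
| IPC5: "ITL0 (Imp \<phi> (Imp \<psi> (And \<phi> \<psi>)))"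
| IPC6: "ITL0 (Imp \<phi> (Or \<phi> \<psi>))"
| IPC7: "ITL0 (Imp \<psi> (Or \<phi> \<psi>))"
| IPC8: "ITL0 (Imp (Imp \<phi> \<chi>) (Imp (Imp \<psi> \<chi>) (Imp (Or \<phi> \<psi>) \<chi>)))"
| IPC9: "ITL0 (Imp Bot \<phi>)"
| N1: "ITL0 (Neg (Nxt Bot))"
| N2: "ITL0 (Imp (And (Nxt \<phi>) (Nxt \<psi>)) (Nxt (And \<phi> \<psi>)))"
| N3: "ITL0 (Imp (Nxt (Or \<phi> \<psi>)) (Or (Nxt \<phi>) (Nxt \<psi>)))"
| N4: "ITL0 (Imp (Nxt (Imp \<phi> \<psi>)) (Imp (Nxt \<phi>) (Nxt \<psi>)))"
| E1: "ITL0 (Imp (Or \<phi> (Nxt (Dia \<phi>))) (Dia \<phi>))"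
| UA1: "ITL0 (Or (Univ \<phi>) (Neg (Univ \<phi>)))"
| UA2: "ITL0 (Imp (Univ (Imp \<phi> \<psi>)) (Imp (Univ \<phi>) (Univ \<psi>)))"
| UA3: "ITL0 (Imp (Univ (Or \<phi> (Univ \<psi>))) (Or (Univ \<phi>) (Univ \<psi>)))"
| UA4: "ITL0 (Imp (Univ \<phi>) \<phi>)"
| UA5: "ITL0 (Imp (Univ \<phi>) (Univ (Univ \<phi>)))"
| UA6: "ITL0 (Iff (Univ \<phi>) (Nxt (Univ \<phi>)))"
| MP: "ITL0 \<phi> \<Longrightarrow> ITL0 (Imp \<phi> \<psi>) \<Longrightarrow> ITL0 \<psi>"
| NecNxt: "ITL0 \<phi> \<Longrightarrow> ITL0 (Nxt \<phi>)"
| MonDia: "ITL0 (Imp \<phi> \<psi>) \<Longrightarrow> ITL0 (Imp (Dia \<phi>) (Dia \<psi>))"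
| IndDia: "ITL0 (Imp (Nxt \<phi>) \<phi>) \<Longrightarrow> ITL0 (Imp (Dia \<phi>) \<phi>)"
| NecUniv: "ITL0 \<phi> \<Longrightarrow> ITL0 (Univ \<phi>)"

end

theory Submission
  imports Defs "HOL-Library.FSet" "HOL-Library.Countable"
begin

text \<open>
  Given a prime theory \<open>G\<close>, the formulas \<open>\<phi>\<close> with \<^term>\<open>Univ \<phi>\<close> in \<open>G\<close> form a logic closed under all
  rules which proves or refutes every \<^term>\<open>Univ \<phi>\<close>, so the universal modality becomes trivial in
  its canonical model of prime theories. That model validates everything except that \<^term>\<open>Dia \<phi>\<close>
  may be promised without ever being realised. This is repaired by passing to finite labelled trees
  (moments) that are simulated by a prime theory: there are finitely many of them, being simulated is
  expressed by a formula, and the induction rule for \<^term>\<open>Dia\<close> applied to the conjunction of these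
  formulas over all reachable moments shows that some reachable moment realises \<^term>\<open>\<phi>\<close>. The
  infinite runs through moments that realise all their promises, with the shift map, form a dynamical
  system refuting every nontheorem.
\<close>

instance fm :: countable
  by countable_datatype

section \<open>Prime theories\<close>

text \<open>Kept abstract because it serves twice: for \<open>ITL0\<close> itself, and for each
  logic of the formulas that a prime theory makes universally true.\<close>

locale intuitionistic_logic =
  fixes L :: "fm \<Rightarrow> bool"
  assumes ax_K: "L (Imp \<phi> (Imp \<psi> \<phi>))"
    and ax_S: "L (Imp (Imp \<phi> (Imp \<psi> \<chi>)) (Imp (Imp \<phi> \<psi>) (Imp \<phi> \<chi>)))"
    and ax_And1: "L (Imp (And \<phi> \<psi>) \<phi>)"
    and ax_And2: "L (Imp (And \<phi> \<psi>) \<psi>)"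
    and ax_AndI: "L (Imp \<phi> (Imp \<psi> (And \<phi> \<psi>)))"
    and ax_Or1: "L (Imp \<phi> (Or \<phi> \<psi>))"
    and ax_Or2: "L (Imp \<psi> (Or \<phi> \<psi>))"
    and ax_OrE: "L (Imp (Imp \<phi> \<chi>) (Imp (Imp \<psi> \<chi>) (Imp (Or \<phi> \<psi>) \<chi>)))"
    and ax_Bot: "L (Imp Bot \<phi>)"
    and mp: "L \<phi> \<Longrightarrow> L (Imp \<phi> \<psi>) \<Longrightarrow> L \<psi>"
begin

text \<open>Closure is under modus ponens only, not under the necessitation rules: a theory collects
  what holds at one point, not what holds everywhere.\<close>

definition closed_theory :: "fm set \<Rightarrow> bool" where
  "closed_theory G \<longleftrightarrow> (\<forall>\<phi>. L \<phi> \<longrightarrow> \<phi> \<in> G) \<and> (\<forall>\<phi> \<psi>. \<phi> \<in> G \<longrightarrow> Imp \<phi> \<psi> \<in> G \<longrightarrow> \<psi> \<in> G)"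

definition prime_theory :: "fm set \<Rightarrow> bool" where
  "prime_theory G \<longleftrightarrow>
     closed_theory G \<and> Bot \<notin> G \<and> (\<forall>\<phi> \<psi>. Or \<phi> \<psi> \<in> G \<longrightarrow> \<phi> \<in> G \<or> \<psi> \<in> G)"

lemma closed_theoryD:
  assumes "closed_theory G"
  shows "L \<phi> \<Longrightarrow> \<phi> \<in> G" and "\<phi> \<in> G \<Longrightarrow> Imp \<phi> \<psi> \<in> G \<Longrightarrow> \<psi> \<in> G"
  using assms unfolding closed_theory_def by metis+

lemma closed_theory_L: "closed_theory {\<phi>. L \<phi>}"
  unfolding closed_theory_def using mp by blast

text \<open>The set is the theory generated by \<open>G\<close> and \<phi>, so this takes the place
  of the deduction theorem. Closure under modus ponens is \<open>ax_S\<close>, and containing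
  \<open>G\<close> is \<open>ax_K\<close>.\<close>

lemma closed_theory_extend:
  assumes G: "closed_theory G"
  shows "closed_theory {\<theta>. Imp \<phi> \<theta> \<in> G}" and "G \<subseteq> {\<theta>. Imp \<phi> \<theta> \<in> G}" and "Imp \<phi> \<phi> \<in> G"
proof -
  note D = closed_theoryD[OF G]
  show sub: "G \<subseteq> {\<theta>. Imp \<phi> \<theta> \<in> G}"
    using D(2) D(1)[OF ax_K] by blast
  show "closed_theory {\<theta>. Imp \<phi> \<theta> \<in> G}"
    unfolding closed_theory_def using sub D(1) D(2) D(2)[OF _ D(1)[OF ax_S]] by blast
  show "Imp \<phi> \<phi> \<in> G"
    using D(2)[OF D(1)[OF ax_K] D(2)[OF D(1)[OF ax_K] D(1)[OF ax_S]]] .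
qed

lemma prime_extension:
  assumes G: "closed_theory G" and x: "\<chi> \<notin> G"
  obtains D where "prime_theory D" "G \<subseteq> D" "\<chi> \<notin> D"
proof -
  let ?A = "{D. closed_theory D \<and> G \<subseteq> D \<and> \<chi> \<notin> D}"
  have "\<exists>M\<in>?A. \<forall>X\<in>?A. M \<subseteq> X \<longrightarrow> X = M"
  proof (rule subset_Zorn_nonempty)
    show "?A \<noteq> {}" using assms by blast
  next
    fix C assume ne: "C \<noteq> {}" and ch: "subset.chain ?A C"
    have lin: "X \<subseteq> Y \<or> Y \<subseteq> X" if "X \<in> C" "Y \<in> C" for X Y
      using ch that by (auto simp: subset_chain_def)
    have mem: "closed_theory X" "G \<subseteq> X" "\<chi> \<notin> X" if "X \<in> C" for X
      using ch that by (auto simp: subset_chain_def)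
    have "\<psi> \<in> \<Union>C" if a: "\<phi> \<in> \<Union>C" and b: "Imp \<phi> \<psi> \<in> \<Union>C" for \<phi> \<psi>
    proof -
      obtain X Y where "\<phi> \<in> X" "X \<in> C" "Imp \<phi> \<psi> \<in> Y" "Y \<in> C" using a b by blast
      with lin[of X Y] closed_theoryD(2)[OF mem(1)[of X]] closed_theoryD(2)[OF mem(1)[of Y]]
      show ?thesis by blast
    qed
    moreover have "\<phi> \<in> \<Union>C" if "L \<phi>" for \<phi>
      using ne mem(1) closed_theoryD(1) that by blast
    ultimately have "closed_theory (\<Union>C)" unfolding closed_theory_def by metis
    then show "\<Union>C \<in> ?A" using ne mem by blast
  qed
  then obtain D where D: "closed_theory D" "G \<subseteq> D" "\<chi> \<notin> D"
    and mx: "\<And>X. closed_theory X \<Longrightarrow> G \<subseteq> X \<Longrightarrow> \<chi> \<notin> X \<Longrightarrow> D \<subseteq> X \<Longrightarrow> X = D"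
    by (smt (verit) mem_Collect_eq)
  note DD = closed_theoryD[OF D(1)]
  \<comment> \<open>By maximality, adding a missing \<phi> must produce \<chi>. If both disjuncts of
    a member were missing, \<open>ax_OrE\<close> would then put \<chi> into \<open>D\<close>, so
    \<open>D\<close> is prime.\<close>
  have imp: "Imp \<phi> \<chi> \<in> D" if "\<phi> \<notin> D" for \<phi>
  proof (rule ccontr)
    assume "Imp \<phi> \<chi> \<notin> D"
    then have "{\<theta>. Imp \<phi> \<theta> \<in> D} = D"
      by (intro mx closed_theory_extend(1,2) D(1) subset_trans[OF D(2) closed_theory_extend(2)]) simp
    then show False using closed_theory_extend(3)[OF D(1), of \<phi>] that by blast
  qed
  have "\<phi> \<in> D \<or> \<psi> \<in> D" if "Or \<phi> \<psi> \<in> D" for \<phi> \<psi>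
    using imp[of \<phi>] imp[of \<psi>] that D(3) DD(2) DD(1)[OF ax_OrE] by blast
  moreover have "Bot \<notin> D" using DD(2) DD(1)[OF ax_Bot] D(3) by blast
  ultimately show ?thesis using that D by (auto simp: prime_theory_def)
qed

lemma L_iff_prime: "L \<chi> \<longleftrightarrow> (\<forall>G. prime_theory G \<longrightarrow> \<chi> \<in> G)"
proof
  show "L \<chi> \<Longrightarrow> \<forall>G. prime_theory G \<longrightarrow> \<chi> \<in> G"
    using closed_theoryD(1) by (auto simp: prime_theory_def)
  show "\<forall>G. prime_theory G \<longrightarrow> \<chi> \<in> G \<Longrightarrow> L \<chi>"
    using prime_extension[OF closed_theory_L, of \<chi>] by blast
qed

context
  fixes G assumes G: "prime_theory G"
begin

lemma prime_closed: "closed_theory G"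
  using G by (simp add: prime_theory_def)

lemma prime_L: "L \<phi> \<Longrightarrow> \<phi> \<in> G"
  using closed_theoryD(1)[OF prime_closed] .

lemma prime_mp: "Imp \<phi> \<psi> \<in> G \<Longrightarrow> \<phi> \<in> G \<Longrightarrow> \<psi> \<in> G"
  using closed_theoryD(2)[OF prime_closed] .

lemma prime_Bot: "Bot \<notin> G"
  using G by (simp add: prime_theory_def)

lemma prime_L_mp: "L (Imp \<phi> \<psi>) \<Longrightarrow> \<phi> \<in> G \<Longrightarrow> \<psi> \<in> G"
  using prime_mp prime_L by blast

lemma prime_And: "And \<phi> \<psi> \<in> G \<longleftrightarrow> \<phi> \<in> G \<and> \<psi> \<in> G"
  using prime_L_mp ax_And1 ax_And2 ax_AndI prime_mp by meson

lemma prime_Or: "Or \<phi> \<psi> \<in> G \<longleftrightarrow> \<phi> \<in> G \<or> \<psi> \<in> G"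
  using prime_L_mp ax_Or1 ax_Or2 G by (meson prime_theory_def)

text \<open>The Kripke clause of the canonical model ordered by inclusion. If the implication is
  missing, the theory generated by \<open>G\<close> and \<phi> omits \<psi> and extends to a prime
  one that still omits it.\<close>

lemma prime_Imp: "Imp \<phi> \<psi> \<in> G \<longleftrightarrow> (\<forall>D. prime_theory D \<longrightarrow> G \<subseteq> D \<longrightarrow> \<phi> \<in> D \<longrightarrow> \<psi> \<in> D)"
proof
  assume "Imp \<phi> \<psi> \<in> G"
  then show "\<forall>D. prime_theory D \<longrightarrow> G \<subseteq> D \<longrightarrow> \<phi> \<in> D \<longrightarrow> \<psi> \<in> D"
    unfolding prime_theory_def using closed_theoryD(2) by blast
next
  assume *: "\<forall>D. prime_theory D \<longrightarrow> G \<subseteq> D \<longrightarrow> \<phi> \<in> D \<longrightarrow> \<psi> \<in> D"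
  show "Imp \<phi> \<psi> \<in> G"
  proof (rule ccontr)
    assume "Imp \<phi> \<psi> \<notin> G"
    then obtain D where "prime_theory D" "{\<theta>. Imp \<phi> \<theta> \<in> G} \<subseteq> D" "\<psi> \<notin> D"
      using prime_extension[OF closed_theory_extend(1)[OF prime_closed, of \<phi>], of \<psi>] by blast
    then show False
      using * closed_theory_extend(2,3)[OF prime_closed, of \<phi>] by blast
  qed
qed

end

text \<open>Lets later derivations be replaced by arguments about membership in prime
  theories.\<close>

lemma L_Imp_iff: "L (Imp \<phi> \<psi>) \<longleftrightarrow> (\<forall>G. prime_theory G \<longrightarrow> \<phi> \<in> G \<longrightarrow> \<psi> \<in> G)"
  using prime_Imp by (auto simp: L_iff_prime)

lemma finite_conjunction:
  assumes "finite A"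
  shows "\<exists>\<chi>. \<forall>G. prime_theory G \<longrightarrow> (\<chi> \<in> G \<longleftrightarrow> A \<subseteq> G)"
  using assms
proof induction
  case empty
  have "\<forall>G. prime_theory G \<longrightarrow> Imp Bot Bot \<in> G" using prime_L ax_Bot by blast
  then show ?case by blast
next
  case (insert \<phi> A)
  then obtain \<chi> where "\<forall>G. prime_theory G \<longrightarrow> (\<chi> \<in> G \<longleftrightarrow> A \<subseteq> G)" by blast
  then have "\<forall>G. prime_theory G \<longrightarrow> (And \<phi> \<chi> \<in> G \<longleftrightarrow> insert \<phi> A \<subseteq> G)"
    using prime_And by simp
  then show ?case by blast
qed

lemma finite_disjunction:
  assumes "finite A"
  shows "\<exists>\<chi>. \<forall>G. prime_theory G \<longrightarrow> (\<chi> \<in> G \<longleftrightarrow> A \<inter> G \<noteq> {})"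
  using assms
proof induction
  case empty
  have "\<forall>G. prime_theory G \<longrightarrow> Bot \<notin> G" using prime_Bot by blast
  then show ?case by (intro exI[of _ Bot]) auto
next
  case (insert \<phi> A)
  then obtain \<chi> where "\<forall>G. prime_theory G \<longrightarrow> (\<chi> \<in> G \<longleftrightarrow> A \<inter> G \<noteq> {})" by blast
  then have "\<forall>G. prime_theory G \<longrightarrow> (Or \<phi> \<chi> \<in> G \<longleftrightarrow> insert \<phi> A \<inter> G \<noteq> {})"
    using prime_Or by auto
  then show ?case by blast
qed

end

section \<open>Temporal logics and the transition of the canonical model\<close>

locale temporal_logic = intuitionistic_logic +
  assumes ax_NBot: "L (Neg (Nxt Bot))"
    and ax_NOr: "L (Imp (Nxt (Or \<phi> \<psi>)) (Or (Nxt \<phi>) (Nxt \<psi>)))"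
    and ax_NImp: "L (Imp (Nxt (Imp \<phi> \<psi>)) (Imp (Nxt \<phi>) (Nxt \<psi>)))"
    and ax_Dia: "L (Imp (Or \<phi> (Nxt (Dia \<phi>))) (Dia \<phi>))"
    and nec_Nxt: "L \<phi> \<Longrightarrow> L (Nxt \<phi>)"
    and mono_Dia: "L (Imp \<phi> \<psi>) \<Longrightarrow> L (Imp (Dia \<phi>) (Dia \<psi>))"
    and ind_Dia: "L (Imp (Nxt \<phi>) \<phi>) \<Longrightarrow> L (Imp (Dia \<phi>) \<phi>)"
begin

definition nx :: "fm set \<Rightarrow> fm set" where
  "nx G = {\<phi>. Nxt \<phi> \<in> G}"

lemma nx_iff [simp]: "\<phi> \<in> nx G \<longleftrightarrow> Nxt \<phi> \<in> G"
  by (simp add: nx_def)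

lemma nx_mono: "G \<subseteq> D \<Longrightarrow> nx G \<subseteq> nx D"
  by (auto simp: nx_def)

lemma prime_nx:
  assumes G: "prime_theory G" shows "prime_theory (nx G)"
  unfolding prime_theory_def closed_theory_def
proof (intro conjI allI impI)
  show "\<phi> \<in> nx G" if "L \<phi>" for \<phi> using prime_L[OF G nec_Nxt[OF that]] by simp
  show "\<psi> \<in> nx G" if "\<phi> \<in> nx G" "Imp \<phi> \<psi> \<in> nx G" for \<phi> \<psi>
    using that prime_L_mp[OF G ax_NImp] prime_mp[OF G] by (meson nx_iff)
  show "Bot \<notin> nx G" using prime_L_mp[OF G ax_NBot[unfolded Neg_def]] prime_Bot[OF G] by auto
  show "\<phi> \<in> nx G \<or> \<psi> \<in> nx G" if "Or \<phi> \<psi> \<in> nx G" for \<phi> \<psi>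
    using that prime_L_mp[OF G ax_NOr] prime_Or[OF G] by (meson nx_iff)
qed

text \<open>The axiom gives only one direction. For the other, \<theta> is a prefixed point of
  \<open>Nxt\<close> that follows from \<phi>; monotonicity and induction therefore lead from
  \<open>Dia \<phi>\<close> through \<open>Dia \<theta>\<close> to \<theta>.\<close>

lemma Dia_unfold:
  assumes G: "prime_theory G"
  shows "Dia \<phi> \<in> G \<longleftrightarrow> \<phi> \<in> G \<or> Dia \<phi> \<in> nx G"
proof
  show "Dia \<phi> \<in> G" if "\<phi> \<in> G \<or> Dia \<phi> \<in> nx G"
    using that prime_L_mp[OF G ax_Dia] prime_Or[OF G] by simp
next
  assume D: "Dia \<phi> \<in> G"
  define \<theta> where "\<theta> = Or \<phi> (Nxt (Dia \<phi>))"
  have up: "Dia \<phi> \<in> H" if "prime_theory H" "\<theta> \<in> H" for H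
    using that prime_L_mp[OF that(1) ax_Dia] by (simp add: \<theta>_def)
  have "L (Imp \<phi> \<theta>)" by (simp add: \<theta>_def ax_Or1)
  then have "L (Imp (Dia \<phi>) (Dia \<theta>))" by (rule mono_Dia)
  moreover have "L (Imp (Nxt \<theta>) \<theta>)"
    unfolding L_Imp_iff
  proof (intro allI impI)
    fix H assume H: "prime_theory H" "Nxt \<theta> \<in> H"
    then have "Dia \<phi> \<in> nx H" using up[OF prime_nx] by simp
    then show "\<theta> \<in> H" using prime_Or[OF H(1)] by (simp add: \<theta>_def)
  qed
  then have "L (Imp (Dia \<theta>) \<theta>)" by (rule ind_Dia)
  ultimately have "\<theta> \<in> G" using D prime_L_mp[OF G] by blast
  then show "\<phi> \<in> G \<or> Dia \<phi> \<in> nx G" using prime_Or[OF G] by (simp add: \<theta>_def)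
qed

end

section \<open>Making the universal modality trivial\<close>

locale universal_temporal_logic = temporal_logic +
  assumes nec_Univ: "L \<phi> \<Longrightarrow> L (Univ \<phi>)"
    and refute_Univ: "\<not> L \<phi> \<Longrightarrow> L (Neg (Univ \<phi>))"
begin

lemma prime_Univ:
  assumes G: "prime_theory G" shows "Univ \<phi> \<in> G \<longleftrightarrow> L \<phi>"
  using prime_L[OF G nec_Univ, of \<phi>] prime_L_mp[OF G refute_Univ[unfolded Neg_def], of \<phi>]
    prime_Bot[OF G] by blast

end

interpretation ITL0: temporal_logic ITL0
proof unfold_locales
qed (fact ITL0.intros[unfolded Neg_def] ITL0.intros)+

text \<open>Each rule is internalised: its conclusion is derived in \<open>ITL0\<close> from the
  boxed premise and then boxed. (UA6) carries the boxed premise through next steps, and (UA1) with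
  (UA3) decides every \<open>Univ \<phi>\<close>.\<close>

lemma relativised_logic:
  assumes G: "ITL0.prime_theory G"
  shows "universal_temporal_logic (\<lambda>\<phi>. Univ \<phi> \<in> G)"
proof -
  note L = ITL0.prime_L[OF G] and mp = ITL0.prime_mp[OF G] and Lmp = ITL0.prime_L_mp[OF G]
  have nec: "Univ \<phi> \<in> G" if "ITL0 \<phi>" for \<phi>
    using L ITL0.NecUniv that by blast
  have UMP: "Univ \<psi> \<in> G" if "Univ (Imp \<phi> \<psi>) \<in> G" "Univ \<phi> \<in> G" for \<phi> \<psi>
    using that Lmp[OF ITL0.UA2] mp by blast
  have UU: "Univ (Univ \<phi>) \<in> G" if "Univ \<phi> \<in> G" for \<phi>
    using that Lmp[OF ITL0.UA5] by blast
  have refl: "\<phi> \<in> H" if "ITL0.prime_theory H" "Univ \<phi> \<in> H" for \<phi> H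
    using that ITL0.prime_L_mp[OF that(1) ITL0.UA4] by blast
  have UN: "Univ \<phi> \<in> ITL0.nx H \<longleftrightarrow> Univ \<phi> \<in> H" if "ITL0.prime_theory H" for \<phi> H
    using ITL0.prime_L[OF that ITL0.UA6[unfolded Iff_def], of \<phi>] ITL0.prime_And[OF that]
      ITL0.prime_mp[OF that] by (meson ITL0.nx_iff)
  have transfer: "Univ \<psi> \<in> G" if "ITL0 (Imp (Univ \<phi>) \<psi>)" "Univ \<phi> \<in> G" for \<phi> \<psi>
    using UMP[OF nec[OF that(1)] UU[OF that(2)]] .
  \<comment> \<open>The induction rule under a hypothesis \<open>A\<close>: since \<open>A\<close> is preserved by the next step, it can be
    absorbed into the invariant \<^term>\<open>Imp A \<theta>\<close>.\<close>
  have ind: "ITL0 (Imp A (Imp (Dia \<phi>) \<theta>))"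
    if A: "A = Univ B" and base: "\<And>H. ITL0.prime_theory H \<Longrightarrow> A \<in> H \<Longrightarrow> \<phi> \<in> H \<Longrightarrow> \<theta> \<in> H"
      and step: "\<And>H. ITL0.prime_theory H \<Longrightarrow> A \<in> H \<Longrightarrow> \<theta> \<in> ITL0.nx H \<Longrightarrow> \<theta> \<in> H" for A B \<phi> \<theta>
  proof -
    have "ITL0 (Imp (Nxt (Imp A \<theta>)) (Imp A \<theta>))"
      unfolding ITL0.L_Imp_iff
    proof (intro allI impI)
      fix H assume H: "ITL0.prime_theory H" "Nxt (Imp A \<theta>) \<in> H"
      have "\<theta> \<in> D" if D: "ITL0.prime_theory D" "H \<subseteq> D" "A \<in> D" for D
      proof (rule step[OF D(1,3)])
        have "A \<in> ITL0.nx D" using UN[OF D(1)] D(3) A by blast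
        moreover have "Imp A \<theta> \<in> ITL0.nx D" using H(2) D(2) by auto
        ultimately show "\<theta> \<in> ITL0.nx D" using ITL0.prime_mp[OF ITL0.prime_nx[OF D(1)]] by blast
      qed
      then show "Imp A \<theta> \<in> H" using ITL0.prime_Imp[OF H(1)] by blast
    qed
    then have "ITL0 (Imp (Dia (Imp A \<theta>)) (Imp A \<theta>))" by (rule ITL0.IndDia)
    moreover have "ITL0 (Imp (Dia \<phi>) (Dia (Imp A \<theta>)))"
    proof (rule ITL0.MonDia)
      show "ITL0 (Imp \<phi> (Imp A \<theta>))"
        using base by (auto simp: ITL0.L_Imp_iff ITL0.prime_Imp)
    qed
    ultimately have *: "Imp A \<theta> \<in> H" if "ITL0.prime_theory H" "Dia \<phi> \<in> H" for H
      using that by (simp add: ITL0.L_Imp_iff)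
    have "Imp (Dia \<phi>) \<theta> \<in> H" if H: "ITL0.prime_theory H" "A \<in> H" for H
      unfolding ITL0.prime_Imp[OF H(1)] using * H(2) ITL0.prime_mp by blast
    then show ?thesis
      by (simp add: ITL0.L_Imp_iff)
  qed
  show ?thesis
  proof unfold_locales
    show "Univ \<psi> \<in> G" if "Univ \<phi> \<in> G" "Univ (Imp \<phi> \<psi>) \<in> G" for \<phi> \<psi>
      using UMP that by blast
    show "Univ (Nxt \<phi>) \<in> G" if "Univ \<phi> \<in> G" for \<phi>
    proof (rule transfer[OF _ that])
      have "Nxt \<phi> \<in> H" if H: "ITL0.prime_theory H" "Univ \<phi> \<in> H" for H
        using refl[OF ITL0.prime_nx[OF H(1)]] UN[OF H(1)] H(2) ITL0.nx_iff by blast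
      then show "ITL0 (Imp (Univ \<phi>) (Nxt \<phi>))" by (simp add: ITL0.L_Imp_iff)
    qed
    \<comment> \<open>The invariant for \<open>ind\<close> is \<open>Dia \<psi>\<close> here and
      \<phi> itself for the induction rule below.\<close>
    show "Univ (Imp (Dia \<phi>) (Dia \<psi>)) \<in> G" if "Univ (Imp \<phi> \<psi>) \<in> G" for \<phi> \<psi>
      by (rule transfer[OF ind that]) (use ITL0.Dia_unfold refl ITL0.prime_mp in blast)+
    show "Univ (Imp (Dia \<phi>) \<phi>) \<in> G" if "Univ (Imp (Nxt \<phi>) \<phi>) \<in> G" for \<phi>
      by (rule transfer[OF ind that]) (use refl ITL0.prime_mp ITL0.nx_iff in blast)+
    show "Univ (Univ \<phi>) \<in> G" if "Univ \<phi> \<in> G" for \<phi>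
      using UU that .
    show "Univ (Neg (Univ \<phi>)) \<in> G" if "Univ \<phi> \<notin> G" for \<phi>
    proof -
      \<comment> \<open>The disjuncts of (UA1) are swapped because (UA3) requires the boxed formula
        on the right.\<close>
      have "ITL0 (Or (Neg (Univ \<phi>)) (Univ \<phi>))"
        using ITL0.prime_L[OF _ ITL0.UA1] ITL0.prime_Or
        by (intro ITL0.L_iff_prime[THEN iffD2] allI impI) blast
      then have "Or (Univ (Neg (Univ \<phi>))) (Univ \<phi>) \<in> G"
        using Lmp[OF ITL0.UA3] nec by blast
      then show ?thesis using that ITL0.prime_Or[OF G] by blast
    qed
  qed (rule nec, fact ITL0.intros)+
qed

section \<open>Transfer along injections\<close>

text \<open>Validity speaks of one fixed carrier type, while the refuting system lives on runs of
  moments. Pulling the topology back along the inverse of \<open>e\<close> gives a homeomorphic copy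
  on the image of \<open>e\<close>, and every semantic clause commutes with the
  homeomorphism.\<close>

lemma valid_dyn_transfer:
  fixes T :: "'b topology" and e :: "'b \<Rightarrow> 'a"
  assumes valid: "valid_dyn TYPE('a) \<phi>" and inj: "inj_on e (topspace T)"
    and dyn: "dyn_system T f" and val: "valuation T V"
  shows "sem T f V \<phi> = topspace T"
proof -
  define g where "g = inv_into (topspace T) e"
  define T' where "T' = pullback_topology (e ` topspace T) g T"
  have ge: "g (e x) = x" if "x \<in> topspace T" for x
    using inj that by (simp add: g_def)
  have top: "topspace T' = e ` topspace T"
    using ge by (auto simp: T'_def topspace_pullback_topology)
  have maps: "homeomorphic_maps T T' e g"
    unfolding homeomorphic_maps_def
  proof (intro conjI ballI)
    show "continuous_map T T' e"
      unfolding T'_def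
      by (rule continuous_map_pullback'[OF continuous_map_eq[OF continuous_map_id]]) (auto simp: ge)
    show "continuous_map T' T g"
      unfolding T'_def using continuous_map_pullback[OF continuous_map_id, where f = g] by simp
  qed (auto simp: top ge)
  then have hm: "homeomorphic_map T T' e" using homeomorphic_maps_map by blast
  define f' where "f' = e \<circ> f \<circ> g"
  define V' where "V' = (\<lambda>p. e ` V p)"
  have fT: "f x \<in> topspace T" if "x \<in> topspace T" for x
    using dyn that by (auto simp: dyn_system_def continuous_map_def)
  have fTn: "(f ^^ n) x \<in> topspace T" if "x \<in> topspace T" for x n
    using that fT by (induction n) auto
  have f'n: "(f' ^^ n) (e x) = e ((f ^^ n) x)" if "x \<in> topspace T" for x n
    using that by (induction n) (auto simp: f'_def ge fTn)
  have dyn': "dyn_system T' f'"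
    unfolding dyn_system_def f'_def
    using maps dyn by (auto simp: homeomorphic_maps_def dyn_system_def intro!: continuous_map_compose)
  have val': "valuation T' V'"
    using val homeomorphic_map_openness_eq[OF hm]
    by (auto simp: valuation_def V'_def openin_subset)
  have sub: "sem T f V \<psi> \<subseteq> topspace T" for \<psi>
    using val by (induction \<psi>) (auto simp: valuation_def openin_subset interior_of_subset_topspace
        dest: openin_subset subsetD[OF interior_of_subset_topspace])
  have img: "e x \<in> e ` A \<longleftrightarrow> x \<in> A" if "x \<in> topspace T" "A \<subseteq> topspace T" for x A
    using that inj by (meson inj_on_image_mem_iff)
  have "sem T' f' V' \<psi> = e ` sem T f V \<psi>" for \<psi>
  proof (induction \<psi>)
    case (And \<phi> \<psi>)
    then show ?case using inj_on_image_Int[OF inj sub sub] by simp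
  next
    case (Imp \<phi> \<psi>)
    have "e ` ((topspace T - sem T f V \<phi>) \<union> sem T f V \<psi>)
        = (topspace T' - e ` sem T f V \<phi>) \<union> e ` sem T f V \<psi>"
      using inj_on_image_set_diff[OF inj Diff_subset sub]
      by (auto simp: top image_Un)
    with Imp homeomorphic_map_interior_of[OF hm, of "(topspace T - sem T f V \<phi>) \<union> sem T f V \<psi>"] sub
    show ?case by auto
  next
    case (Nxt \<phi>)
    have "f' (e x) \<in> e ` sem T f V \<phi> \<longleftrightarrow> f x \<in> sem T f V \<phi>" if "x \<in> topspace T" for x
      using that img[OF fT sub] f'n[of x 1] by simp
    with Nxt show ?case by (auto simp: top)
  next
    case (Dia \<phi>)
    have "(f' ^^ n) (e x) \<in> e ` sem T f V \<phi> \<longleftrightarrow> (f ^^ n) x \<in> sem T f V \<phi>" if "x \<in> topspace T" for x n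
      using that img[OF fTn sub] f'n by simp
    then have "{y \<in> topspace T'. (f' ^^ n) y \<in> sem T' f' V' \<phi>}
        = e ` {x \<in> topspace T. (f ^^ n) x \<in> sem T f V \<phi>}" for n
      unfolding top Dia.IH by blast
    then show ?case by (simp add: image_UN)
  next
    case (Univ \<phi>)
    have "e ` sem T f V \<phi> = e ` topspace T \<longleftrightarrow> sem T f V \<phi> = topspace T"
      using inj_on_image_eq_iff[OF inj sub] by blast
    with Univ show ?case by (auto simp: top)
  qed (auto simp: V'_def image_Un)
  moreover have "sem T' f' V' \<phi> = topspace T'"
    using valid dyn' val' by (simp add: valid_dyn_def)
  ultimately show ?thesis
    using inj_on_image_eq_iff[OF inj sub, of "topspace T"] by (simp add: top)
qed

section \<open>Moments\<close>

text \<open>With \<open>fset\<close>, trees having the same label and the same set of immediate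
  subtrees are equal; without this identification bounded height would not make them finite in
  number.\<close>

datatype moment = Moment (label: "fm set") (above: "moment fset")

inductive below :: "moment \<Rightarrow> moment \<Rightarrow> bool" where
  below_refl: "below w w"
| below_above: "u \<in> fset (above w) \<Longrightarrow> below u v \<Longrightarrow> below w v"

lemma below_trans: "below u v \<Longrightarrow> below v w \<Longrightarrow> below u w"
  by (induction rule: below.induct) (auto intro: below.intros)

text \<open>Proper subtrees lie below some child, so they survive when the root is replaced by one
  with more children.\<close>

lemma below_replace_root:
  assumes "below v u" "fset (above v) \<subseteq> fset (above v')"
  shows "u = v \<or> below v' u"
  using assms by (cases rule: below.cases) (auto intro: below.intros)

section \<open>Moments over a finite set closed under subformulas\<close>

locale filtration = universal_temporal_logic +
  fixes \<Sigma> :: "fm set"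
  assumes fin: "finite \<Sigma>"
    and sub_And: "And \<phi> \<psi> \<in> \<Sigma> \<Longrightarrow> \<phi> \<in> \<Sigma> \<and> \<psi> \<in> \<Sigma>"
    and sub_Or: "Or \<phi> \<psi> \<in> \<Sigma> \<Longrightarrow> \<phi> \<in> \<Sigma> \<and> \<psi> \<in> \<Sigma>"
    and sub_Imp: "Imp \<phi> \<psi> \<in> \<Sigma> \<Longrightarrow> \<phi> \<in> \<Sigma> \<and> \<psi> \<in> \<Sigma>"
    and sub_Nxt: "Nxt \<phi> \<in> \<Sigma> \<Longrightarrow> \<phi> \<in> \<Sigma>"
    and sub_Dia: "Dia \<phi> \<in> \<Sigma> \<Longrightarrow> \<phi> \<in> \<Sigma>"
    and sub_Univ: "Univ \<phi> \<in> \<Sigma> \<Longrightarrow> \<phi> \<in> \<Sigma>"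
begin

text \<open>Strict growth of the labels bounds the height and so makes the set of moments finite.\<close>

inductive moment_ok :: "moment \<Rightarrow> bool" where
  "label w \<subseteq> \<Sigma> \<Longrightarrow>
   (\<And>v. v \<in> fset (above w) \<Longrightarrow> moment_ok v \<and> label w \<subset> label v) \<Longrightarrow>
   (\<And>\<phi> \<psi>. Imp \<phi> \<psi> \<in> \<Sigma> - label w \<Longrightarrow> \<exists>v. below w v \<and> \<phi> \<in> label v \<and> \<psi> \<notin> label v) \<Longrightarrow>
   moment_ok w"

text \<open>One-directional: every node must be matched by an extension of \<open>G\<close>, but
  extensions of \<open>G\<close> need not occur in the tree. Witnesses for refuted implications are
  demanded by \<open>moment_ok\<close> instead.\<close>

inductive sim :: "moment \<Rightarrow> fm set \<Rightarrow> bool" where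
  "prime_theory G \<Longrightarrow> label w = G \<inter> \<Sigma> \<Longrightarrow>
   (\<And>v. v \<in> fset (above w) \<Longrightarrow> \<exists>D. G \<subseteq> D \<and> sim v D) \<Longrightarrow> sim w G"

text \<open>A relation, since different theories simulating one moment may call for different
  successors; a function is regained by shifting runs. The last clause is forward confluence, which
  later lifts a path to one starting higher up.\<close>

inductive step :: "moment \<Rightarrow> moment \<Rightarrow> bool" where
  "(\<And>\<psi>. Nxt \<psi> \<in> \<Sigma> \<Longrightarrow> Nxt \<psi> \<in> label w \<longleftrightarrow> \<psi> \<in> label v) \<Longrightarrow>
   (\<And>\<psi>. Dia \<psi> \<in> \<Sigma> \<Longrightarrow> Dia \<psi> \<in> label w \<longleftrightarrow> \<psi> \<in> label w \<or> Dia \<psi> \<in> label v) \<Longrightarrow>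
   (\<And>w'. w' \<in> fset (above w) \<Longrightarrow> \<exists>v'. below v v' \<and> step w' v') \<Longrightarrow>
   step w v"

lemma moment_okD:
  assumes "moment_ok w"
  shows "label w \<subseteq> \<Sigma>" and "v \<in> fset (above w) \<Longrightarrow> moment_ok v \<and> label w \<subset> label v"
    and "Imp \<phi> \<psi> \<in> \<Sigma> - label w \<Longrightarrow> \<exists>v. below w v \<and> \<phi> \<in> label v \<and> \<psi> \<notin> label v"
  using assms by (cases rule: moment_ok.cases; blast)+

lemma simD:
  assumes "sim w G"
  shows "prime_theory G" and "label w = G \<inter> \<Sigma>"
    and "v \<in> fset (above w) \<Longrightarrow> \<exists>D. G \<subseteq> D \<and> sim v D"
  using assms by (auto elim: sim.cases)

lemma step_above:
  assumes "step w v" "w' \<in> fset (above w)"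
  shows "\<exists>v'. below v v' \<and> step w' v'"
  using assms by (auto elim: step.cases)

text \<open>A moment is determined by its label and its set of children, and the children miss fewer
  formulas of \<Sigma>. So each bound on the number of missing formulas leaves finitely many
  choices, given those for the previous bound.\<close>

lemma finite_moments: "finite {w. moment_ok w}"
proof -
  have "finite {w. moment_ok w \<and> card (\<Sigma> - label w) < n}" for n
  proof (induction n)
    case (Suc n)
    let ?F = "{w. moment_ok w \<and> card (\<Sigma> - label w) < n}"
    have "{w. moment_ok w \<and> card (\<Sigma> - label w) < Suc n}
        \<subseteq> (\<lambda>(x, C). Moment x C) ` (Pow \<Sigma> \<times> (fset -` Pow ?F))"
    proof
      fix w assume w: "w \<in> {w. moment_ok w \<and> card (\<Sigma> - label w) < Suc n}"
      then have ok: "moment_ok w" by simp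
      have "card (\<Sigma> - label v) < n" if "v \<in> fset (above w)" for v
      proof -
        have "label w \<subset> label v" "label v \<subseteq> \<Sigma>"
          using moment_okD[OF ok] moment_okD(1) that by blast+
        then have "card (\<Sigma> - label v) < card (\<Sigma> - label w)"
          by (intro psubset_card_mono) (use fin in auto)
        then show ?thesis using w by simp
      qed
      then have "fset (above w) \<subseteq> ?F" "label w \<subseteq> \<Sigma>"
        using moment_okD(1,2)[OF ok] by blast+
      then show "w \<in> (\<lambda>(x, C). Moment x C) ` (Pow \<Sigma> \<times> (fset -` Pow ?F))"
        by (cases w) auto
    qed
    moreover have "inj fset" by (simp add: inj_def fset_inject)
    then have "finite (fset -` Pow ?F)"
      using Suc by (intro finite_vimageI) auto
    ultimately show ?case
      using fin by (auto intro: finite_subset)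
  qed simp
  from this[of "Suc (card \<Sigma>)"] show ?thesis
    by (rule finite_subset[rotated]) (auto simp: fin card_mono less_Suc_eq_le)
qed

lemma moment_ok_below:
  assumes "below w v" "moment_ok w"
  shows "moment_ok v \<and> label w \<subseteq> label v"
  using assms
proof induction
  case (below_above u w v)
  then have "moment_ok u \<and> label w \<subset> label u"
    using moment_okD(2)[of w u] by simp
  with below_above show ?case by blast
qed simp

lemma sim_below:
  assumes "below w v" "sim w G"
  shows "\<exists>D. G \<subseteq> D \<and> sim v D"
  using assms
proof (induction arbitrary: G)
  case (below_above u w v)
  then obtain D where "G \<subseteq> D" "sim u D" using simD(3)[of w G u] by blast
  with below_above.IH[of D] show ?case by blast
qed blast

lemma step_below:
  assumes "below w w'" "step w v"
  shows "\<exists>v'. below v v' \<and> step w' v'"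
  using assms
proof (induction arbitrary: v)
  case (below_refl w)
  then show ?case using below.below_refl by blast
next
  case (below_above u w x)
  then obtain v' where "below v v'" "step u v'" using step_above by blast
  with below_above.IH[of v'] show ?case using below_trans by blast
qed

text \<open>Nodes above \<^term>\<open>w\<close> may step to the root of \<^term>\<open>v\<close>, so enlarging the root of \<^term>\<open>v\<close>
  changes their targets as well; hence the induction.\<close>

lemma step_replace_root:
  assumes "step w v" "label v' = label v" "fset (above v) \<subseteq> fset (above v')"
  shows "step w v'"
  using assms
proof (induction rule: step.induct)
  case (1 w v)
  show ?case
  proof (rule step.intros)
    fix w' assume "w' \<in> fset (above w)"
    then obtain u where "below v u" "step w' u" "label v' = label u \<Longrightarrow> fset (above u) \<subseteq> fset (above v') \<Longrightarrow> step w' v'"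
      using 1(3) by blast
    then show "\<exists>u. below v' u \<and> step w' u"
      using below_replace_root[of v u v'] 1(4,5) below_refl by metis
  qed (use 1 in auto)
qed

lemma step_labels:
  assumes G: "prime_theory G"
  shows "Nxt \<psi> \<in> \<Sigma> \<Longrightarrow> Nxt \<psi> \<in> G \<inter> \<Sigma> \<longleftrightarrow> \<psi> \<in> nx G \<inter> \<Sigma>"
    and "Dia \<psi> \<in> \<Sigma> \<Longrightarrow> Dia \<psi> \<in> G \<inter> \<Sigma> \<longleftrightarrow> \<psi> \<in> G \<inter> \<Sigma> \<or> Dia \<psi> \<in> nx G \<inter> \<Sigma>"
  using sub_Nxt[of \<psi>] sub_Dia[of \<psi>] Dia_unfold[OF G, of \<psi>] by auto

text \<open>Induction on the number of formulas of \<Sigma> missing from \<open>G\<close>: each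
  implication not refuted by \<open>G\<close> itself receives a child from a prime extension that
  contains its antecedent and so misses fewer formulas.\<close>

lemma moment_exists:
  assumes "prime_theory G"
  shows "\<exists>w. moment_ok w \<and> sim w G"
  using assms
proof (induction "card (\<Sigma> - G)" arbitrary: G rule: less_induct)
  case less
  note G = less.prems
  \<comment> \<open>If the antecedent lies in \<open>G\<close>, the root refutes the implication.
    Only the remaining implications need a child, and for them the new antecedent makes the label
    grow strictly.\<close>
  define B where "B = {\<chi> \<in> \<Sigma> - G. \<exists>\<phi> \<psi>. \<chi> = Imp \<phi> \<psi> \<and> \<phi> \<notin> G}"
  have "\<forall>\<chi>\<in>B. \<exists>u. moment_ok u \<and> (\<exists>D. G \<subseteq> D \<and> sim u D) \<and> G \<inter> \<Sigma> \<subset> label u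
      \<and> (\<forall>\<phi> \<psi>. \<chi> = Imp \<phi> \<psi> \<longrightarrow> \<phi> \<in> label u \<and> \<psi> \<notin> label u)"
  proof
    fix \<chi> assume "\<chi> \<in> B"
    then obtain \<phi> \<psi> where chi: "\<chi> = Imp \<phi> \<psi>" "\<phi> \<notin> G" "Imp \<phi> \<psi> \<in> \<Sigma>" "Imp \<phi> \<psi> \<notin> G"
      by (auto simp: B_def)
    then obtain D where D: "prime_theory D" "G \<subseteq> D" "\<phi> \<in> D" "\<psi> \<notin> D"
      using prime_Imp[OF G] by blast
    have "\<Sigma> - D \<subset> \<Sigma> - G" using D chi sub_Imp by blast
    then have "card (\<Sigma> - D) < card (\<Sigma> - G)" by (intro psubset_card_mono) (use fin in auto)
    from less.hyps[OF this D(1)] obtain u where u: "moment_ok u" "sim u D" by blast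
    then show "\<exists>u. moment_ok u \<and> (\<exists>D. G \<subseteq> D \<and> sim u D) \<and> G \<inter> \<Sigma> \<subset> label u
      \<and> (\<forall>\<phi> \<psi>. \<chi> = Imp \<phi> \<psi> \<longrightarrow> \<phi> \<in> label u \<and> \<psi> \<notin> label u)"
      using simD(2)[OF u(2)] D chi sub_Imp[OF chi(3)] by (intro exI[of _ u]) auto
  qed
  from bchoice[OF this] obtain g where g: "\<forall>\<chi>\<in>B. moment_ok (g \<chi>) \<and> (\<exists>D. G \<subseteq> D \<and> sim (g \<chi>) D) \<and> G \<inter> \<Sigma> \<subset> label (g \<chi>)
      \<and> (\<forall>\<phi> \<psi>. \<chi> = Imp \<phi> \<psi> \<longrightarrow> \<phi> \<in> label (g \<chi>) \<and> \<psi> \<notin> label (g \<chi>))" ..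
  define w where "w = Moment (G \<inter> \<Sigma>) (Abs_fset (g ` B))"
  have "finite B" using fin by (auto simp: B_def)
  then have w: "label w = G \<inter> \<Sigma>" "fset (above w) = g ` B"
    by (simp_all add: w_def Abs_fset_inverse)
  have "sim w G"
    by (rule sim.intros) (use G w g in auto)
  moreover have "moment_ok w"
  proof (rule moment_ok.intros)
    fix \<phi> \<psi> assume a: "Imp \<phi> \<psi> \<in> \<Sigma> - label w"
    then have "\<psi> \<notin> G" using prime_L_mp[OF G ax_K] w by auto
    show "\<exists>v. below w v \<and> \<phi> \<in> label v \<and> \<psi> \<notin> label v"
    proof (cases "\<phi> \<in> G")
      case True
      then show ?thesis using a \<open>\<psi> \<notin> G\<close> w sub_Imp[of \<phi> \<psi>] by (intro exI[of _ w]) (auto intro: below.intros)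
    next
      case False
      then have "Imp \<phi> \<psi> \<in> B" using a w by (auto simp: B_def)
      moreover from this have "below w (g (Imp \<phi> \<psi>))"
        by (intro below_above[OF _ below_refl]) (simp add: w)
      ultimately show ?thesis using g by blast
    qed
  qed (use g w in auto)
  ultimately show ?case by blast
qed

text \<open>The targets of the nodes above \<^term>\<open>w\<close> are put above the new root; a target with the same
  label as the root would violate strict growth, so it is merged into the root.\<close>

lemma step_exists:
  assumes "sim w G"
  shows "\<exists>v. moment_ok v \<and> step w v \<and> sim v (nx G)"
  using assms
proof (induction rule: sim.induct)
  case (1 G w)
  note G = 1(1)
  let ?x = "nx G \<inter> \<Sigma>"
  \<comment> \<open>The proper subtrees of \<open>v0\<close> will witness the implications refuted
    by \<open>nx G\<close>; if the witness is \<open>v0\<close> itself, the new root serves, having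
    the same label.\<close>
  obtain v0 where v0: "moment_ok v0" "sim v0 (nx G)"
    using moment_exists[OF prime_nx[OF G]] by blast
  have "\<forall>w'\<in>fset (above w). \<exists>v. moment_ok v \<and> step w' v \<and> (\<exists>D. nx G \<subseteq> D \<and> sim v D)"
    using 1(3) nx_mono by meson
  from bchoice[OF this] obtain g where g: "\<forall>w'\<in>fset (above w). moment_ok (g w') \<and> step w' (g w') \<and> (\<exists>D. nx G \<subseteq> D \<and> sim (g w') D)" ..
  have g_label: "?x \<subseteq> label (g w')" if "w' \<in> fset (above w)" for w'
    using g that simD(2) by blast
  define E where "E = {w' \<in> fset (above w). label (g w') = ?x}"
  define A where "A = fset (above v0) \<union> (\<Union>w'\<in>E. fset (above (g w'))) \<union> g ` (fset (above w) - E)"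
  define v where "v = Moment ?x (Abs_fset A)"
  have "finite A" by (auto simp: A_def E_def)
  then have v: "label v = ?x" "fset (above v) = A"
    by (simp_all add: v_def Abs_fset_inverse)
  have A: "moment_ok c \<and> ?x \<subset> label c \<and> (\<exists>D. nx G \<subseteq> D \<and> sim c D)" if c: "c \<in> A" for c
  proof -
    consider "c \<in> fset (above v0)" | w' where "w' \<in> E" "c \<in> fset (above (g w'))"
      | w' where "w' \<in> fset (above w) - E" "c = g w'"
      using c by (auto simp: A_def)
    then show ?thesis
    proof cases
      case 1
      then have "moment_ok c \<and> label v0 \<subset> label c" using moment_okD(2)[OF v0(1)] by blast
      then show ?thesis using simD(2,3)[OF v0(2)] 1 by auto
    next
      case 2
      then have w': "w' \<in> fset (above w)" "label (g w') = ?x" by (auto simp: E_def)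
      then have "moment_ok c \<and> label (g w') \<subset> label c" using 2 g moment_okD(2) by blast
      moreover obtain D where "nx G \<subseteq> D" "sim (g w') D" using g w' by blast
      then have "\<exists>D. nx G \<subseteq> D \<and> sim c D" using simD(3)[OF _ 2(2)] by (meson subset_trans)
      ultimately show ?thesis using w' by simp
    next
      case 3
      then show ?thesis using g g_label[of w'] by (auto simp: E_def)
    qed
  qed
  have "sim v (nx G)"
    by (rule sim.intros) (use prime_nx[OF G] v A in auto)
  moreover have "moment_ok v"
  proof (rule moment_ok.intros)
    fix \<phi> \<psi> assume "Imp \<phi> \<psi> \<in> \<Sigma> - label v"
    then obtain u where u: "below v0 u" "\<phi> \<in> label u" "\<psi> \<notin> label u"
      using moment_okD(3)[OF v0(1), of \<phi> \<psi>] v(1) simD(2)[OF v0(2)] by auto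
    have "u = v0 \<or> below v u"
      by (rule below_replace_root[OF u(1)]) (auto simp: v A_def)
    then show "\<exists>u. below v u \<and> \<phi> \<in> label u \<and> \<psi> \<notin> label u"
      using u v(1) simD(2)[OF v0(2)] below_refl by metis
  qed (use A v in auto)
  moreover have "step w v"
  proof (rule step.intros)
    fix w' assume w': "w' \<in> fset (above w)"
    show "\<exists>v'. below v v' \<and> step w' v'"
    proof (cases "w' \<in> E")
      case True
      then have "step w' v"
        using g w' v(1) step_replace_root[of w' "g w'" v] by (auto simp: v(2) A_def E_def)
      then show ?thesis using below_refl by blast
    next
      case False
      then have "g w' \<in> fset (above v)" using w' v by (auto simp: A_def)
      then have "below v (g w')" using below_above below_refl by blast
      then show ?thesis using g w' by blast
    qed
  qed (use step_labels[OF G] 1(2) v(1) in auto)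
  ultimately show ?case by blast
qed

text \<open>For \<^term>\<open>w\<close> with label \<open>x\<close> the formula says that the conjunction of \<open>x\<close> implies the disjunction of \<open>\<Sigma> - x\<close> and of
  the formulas of the nodes above \<^term>\<open>w\<close>.\<close>

lemma simulation_formula:
  "\<exists>\<chi>. \<forall>G. prime_theory G \<longrightarrow> (\<chi> \<notin> G \<longleftrightarrow> (\<exists>D. G \<subseteq> D \<and> sim w D))"
proof (induction w)
  case (Moment x C)
  then obtain s where s: "\<And>v G. v \<in> fset C \<Longrightarrow> prime_theory G \<Longrightarrow> s v \<notin> G \<longleftrightarrow> (\<exists>D. G \<subseteq> D \<and> sim v D)"
    by metis
  show ?case
  proof (cases "x \<subseteq> \<Sigma>")
    case True
    obtain \<alpha> where \<alpha>: "\<And>G. prime_theory G \<Longrightarrow> \<alpha> \<in> G \<longleftrightarrow> x \<subseteq> G"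
      using finite_conjunction[OF finite_subset[OF True fin]] by blast
    have "finite ((\<Sigma> - x) \<union> s ` fset C)" using fin by simp
    from finite_disjunction[OF this] obtain \<beta> where
      \<beta>: "\<And>G. prime_theory G \<Longrightarrow> \<beta> \<in> G \<longleftrightarrow> ((\<Sigma> - x) \<union> s ` fset C) \<inter> G \<noteq> {}"
      by blast
    have key: "\<alpha> \<in> D \<and> \<beta> \<notin> D \<longleftrightarrow> sim (Moment x C) D" if D: "prime_theory D" for D
    proof -
      have "\<alpha> \<in> D \<and> \<beta> \<notin> D \<longleftrightarrow> x = D \<inter> \<Sigma> \<and> (\<forall>v\<in>fset C. s v \<notin> D)"
        using \<alpha>[OF D] \<beta>[OF D] True by auto
      also have "\<dots> \<longleftrightarrow> sim (Moment x C) D"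
        using s[OF _ D] D by (subst sim.simps) auto
      finally show ?thesis .
    qed
    \<comment> \<open>By \<open>prime_Imp\<close> a failing implication means a prime extension with
      \<alpha> and without \<beta>, which by \<open>key\<close> is exactly a theory simulating the
      tree.\<close>
    have "Imp \<alpha> \<beta> \<notin> G \<longleftrightarrow> (\<exists>D. G \<subseteq> D \<and> sim (Moment x C) D)" if G: "prime_theory G" for G
      using key simD(1) unfolding prime_Imp[OF G] by blast
    then show ?thesis by blast
  next
    case False
    \<comment> \<open>A label outside \<Sigma> is never simulated, so any theorem serves as
      \<chi>.\<close>
    then have "\<not> sim (Moment x C) D" for D using simD(2) by fastforce
    moreover have "\<forall>G. prime_theory G \<longrightarrow> Imp Bot Bot \<in> G" using prime_L ax_Bot by blast
    ultimately show ?thesis by blast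
  qed
qed

section \<open>Simulated moments and the realisation of \<open>Dia\<close>\<close>

definition moments :: "moment set" where
  "moments = {w. moment_ok w \<and> (\<exists>G. sim w G)}"

lemma finite_realised_moments: "finite moments"
  using finite_moments by (auto simp: moments_def intro: finite_subset)

lemma moments_label:
  assumes "w \<in> moments" obtains G where "prime_theory G" "label w = G \<inter> \<Sigma>"
  using assms simD(1,2) unfolding moments_def by blast

lemma moments_below: "w \<in> moments \<Longrightarrow> below w v \<Longrightarrow> v \<in> moments \<and> label w \<subseteq> label v"
  using sim_below moment_ok_below unfolding moments_def by blast

lemma moments_step: "w \<in> moments \<Longrightarrow> \<exists>v\<in>moments. step w v"
  using step_exists unfolding moments_def by blast

lemma moments_Imp:
  assumes "w \<in> moments" "Imp \<phi> \<psi> \<in> \<Sigma> - label w"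
  shows "\<exists>v. below w v \<and> \<phi> \<in> label v \<and> \<psi> \<notin> label v"
  using assms unfolding moments_def using moment_okD(3) by blast

abbreviation steps :: "moment \<Rightarrow> moment \<Rightarrow> bool" where
  "steps \<equiv> (\<lambda>u v. step u v \<and> v \<in> moments)\<^sup>*\<^sup>*"

lemma moments_steps: "steps w v \<Longrightarrow> w \<in> moments \<Longrightarrow> v \<in> moments"
  by (induction rule: rtranclp_induct) auto

text \<open>If no moment reachable from \<^term>\<open>w\<close> realised \<^term>\<open>\<psi>\<close>, then the conjunction of the
  simulation formulas of all these moments would follow from \<^term>\<open>\<psi>\<close> and be inductive,
  hence follow from \<^term>\<open>Dia \<psi>\<close>.\<close>

lemma moments_Dia:
  assumes w: "w \<in> moments" and D: "Dia \<psi> \<in> label w"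
  shows "\<exists>v. steps w v \<and> \<psi> \<in> label v"
proof (rule ccontr)
  assume no: "\<not> ?thesis"
  obtain s where s: "\<And>v G. prime_theory G \<Longrightarrow> s v \<notin> G \<longleftrightarrow> (\<exists>D. G \<subseteq> D \<and> sim v D)"
    using simulation_formula by metis
  define R where "R = {v. steps w v}"
  have RM: "R \<subseteq> moments" using moments_steps w by (auto simp: R_def)
  then have "finite (s ` R)" using finite_subset finite_realised_moments by blast
  from finite_conjunction[OF this] obtain \<chi>
    where \<chi>: "\<And>G. prime_theory G \<Longrightarrow> \<chi> \<in> G \<longleftrightarrow> s ` R \<subseteq> G" by blast
  obtain G where G: "sim w G" using w by (auto simp: moments_def)
  note pG = simD(1)[OF G]
  have "w \<in> R" by (simp add: R_def)
  \<comment> \<open>If \<open>s v\<close> fails at \<open>H\<close>, some extension \<open>D\<close>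
    simulates \<open>v\<close>, and \<open>step_exists\<close> yields a successor \<open>u\<close>
    simulated by \<open>nx D\<close>. This \<open>u\<close> is again in \<open>R\<close>, contrary
    to \<chi> holding at \<open>nx D\<close>.\<close>
  have "L (Imp (Nxt \<chi>) \<chi>)"
    unfolding L_Imp_iff
  proof (intro allI impI)
    fix H assume H: "prime_theory H" "Nxt \<chi> \<in> H"
    have "s v \<in> H" if v: "v \<in> R" for v
    proof (rule ccontr)
      assume "s v \<notin> H"
      then obtain D where D: "H \<subseteq> D" "sim v D" using s[OF H(1)] by blast
      then obtain u where u: "moment_ok u" "step v u" "sim u (nx D)" using step_exists by blast
      then have "u \<in> R"
        using v by (auto simp: R_def moments_def intro: rtranclp.rtrancl_into_rtrancl)
      moreover have pD: "prime_theory (nx D)" using D simD(1) prime_nx by blast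
      moreover have "\<chi> \<in> nx D" using H(2) D(1) by auto
      ultimately have "s u \<in> nx D" using \<chi> by blast
      then show False using s[OF pD] u(3) by blast
    qed
    then show "\<chi> \<in> H" using \<chi>[OF H(1)] by blast
  qed
  then have "L (Imp (Dia \<chi>) \<chi>)" by (rule ind_Dia)
  moreover have "L (Imp \<psi> \<chi>)"
    unfolding L_Imp_iff
  proof (intro allI impI)
    fix H assume H: "prime_theory H" "\<psi> \<in> H"
    have "s v \<in> H" if v: "v \<in> R" for v
    proof (rule ccontr)
      assume "s v \<notin> H"
      then obtain D where "H \<subseteq> D" "sim v D" using s[OF H(1)] by blast
      moreover have "\<psi> \<in> \<Sigma>" using D simD(2)[OF G] sub_Dia by blast
      ultimately have "\<psi> \<in> label v" using H(2) simD(2)[of v D] by blast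
      then show False using no v by (auto simp: R_def)
    qed
    then show "\<chi> \<in> H" using \<chi>[OF H(1)] by blast
  qed
  then have "L (Imp (Dia \<psi>) (Dia \<chi>))" by (rule mono_Dia)
  moreover have "Dia \<psi> \<in> G" using D simD(2)[OF G] by blast
  ultimately have "\<chi> \<in> G" using prime_L_mp[OF pG] by blast
  then have "s w \<in> G" using \<chi>[OF pG] \<open>w \<in> R\<close> by blast
  then show False using s[OF pG] G by blast
qed

section \<open>The space of realising runs\<close>

text \<open>Paths are total functions of which only the values at indices up to and including
  \<open>n\<close> count.\<close>

definition path :: "(nat \<Rightarrow> moment) \<Rightarrow> nat \<Rightarrow> bool" where
  "path r n \<longleftrightarrow> (\<forall>i\<le>n. r i \<in> moments) \<and> (\<forall>i<n. step (r i) (r (Suc i)))"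

definition runs :: "(nat \<Rightarrow> moment) set" where
  "runs = {r. (\<forall>i. r i \<in> moments) \<and> (\<forall>i. step (r i) (r (Suc i)))
     \<and> (\<forall>i \<psi>. Dia \<psi> \<in> label (r i) \<longrightarrow> (\<exists>j\<ge>i. \<psi> \<in> label (r j)))}"

lemma step_label_Nxt: "step w v \<Longrightarrow> Nxt \<psi> \<in> \<Sigma> \<Longrightarrow> Nxt \<psi> \<in> label w \<longleftrightarrow> \<psi> \<in> label v"
  by (erule step.cases) simp

lemma step_label_Dia:
  "step w v \<Longrightarrow> Dia \<psi> \<in> \<Sigma> \<Longrightarrow> Dia \<psi> \<in> label w \<longleftrightarrow> \<psi> \<in> label w \<or> Dia \<psi> \<in> label v"
  by (erule step.cases) simp

lemma moments_label_subset: "w \<in> moments \<Longrightarrow> label w \<subseteq> \<Sigma>"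
  using moments_label by blast

lemma path_append:
  assumes r: "path r n" and f: "path f k" "f 0 = r n"
  shows "path (\<lambda>i. if i \<le> n then r i else f (i - n)) (n + k)"
  unfolding path_def
proof (intro conjI allI impI)
  fix i assume i: "i < n + k"
  consider "i < n" | "i = n" | "i > n" by linarith
  then show "step (if i \<le> n then r i else f (i - n)) (if Suc i \<le> n then r (Suc i) else f (Suc i - n))"
  proof cases
    case 2
    then have "step (f 0) (f (Suc 0))" using f(1) i by (auto simp: path_def)
    then show ?thesis using 2 f(2) by simp
  next
    case 3
    then have "step (f (i - n)) (f (Suc (i - n)))" using f(1) i by (auto simp: path_def)
    then show ?thesis using 3 by (simp add: Suc_diff_le)
  qed (use r in \<open>auto simp: path_def\<close>)
qed (use r f in \<open>auto simp: path_def\<close>)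

lemma path_extend_one:
  assumes "path r n"
  obtains r' where "path r' (Suc n)" "\<forall>i\<le>n. r' i = r i"
proof -
  obtain v where v: "v \<in> moments" "step (r n) v"
    using moments_step[of "r n"] assms by (auto simp: path_def)
  have "path (\<lambda>i. if i = 0 then r n else v) 1"
    using v assms by (auto simp: path_def)
  from path_append[OF assms this] show ?thesis
    by (intro that) auto
qed

lemma path_Dia:
  assumes r: "path r n" and D: "Dia \<psi> \<in> label (r n)"
  obtains r' m where "n \<le> m" "path r' m" "\<forall>i\<le>n. r' i = r i" "\<psi> \<in> label (r' m)"
proof -
  have rn: "r n \<in> moments" using r by (simp add: path_def)
  obtain v where v: "steps (r n) v" "\<psi> \<in> label v" using moments_Dia[OF rn D] by blast
  then obtain k f where f: "f 0 = r n" "f k = v" "\<forall>i<k. step (f i) (f (Suc i)) \<and> f (Suc i) \<in> moments"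
    unfolding rtranclp_power relpowp_fun_conv by blast
  have "f i \<in> moments" if "i \<le> k" for i
    using that f rn by (cases i) auto
  then have "path f k" using f by (auto simp: path_def)
  from path_append[OF r this f(1)] show ?thesis
    using f v by (intro that[of "n + k" "\<lambda>i. if i \<le> n then r i else f (i - n)"]) auto
qed

text \<open>An unrealised promise is handed on by every step, so an open promise from any earlier
  index can be settled by extending the path at its end.\<close>

lemma path_Dia_later:
  assumes r: "path r n" and i: "i \<le> n" and D: "Dia \<psi> \<in> label (r i)"
  shows "(\<exists>j. i \<le> j \<and> j \<le> n \<and> \<psi> \<in> label (r j)) \<or> Dia \<psi> \<in> label (r n)"
  using i r
proof (induction rule: dec_induct)
  case (step m)
  then have "path r m" "r m \<in> moments" "step (r m) (r (Suc m))" by (auto simp: path_def)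
  then have "Dia \<psi> \<in> label (r m) \<Longrightarrow> \<psi> \<in> label (r m) \<or> Dia \<psi> \<in> label (r (Suc m))"
    using step_label_Dia[of "r m" "r (Suc m)" \<psi>] moments_label_subset[of "r m"] by blast
  then show ?case
    using step.IH \<open>path r m\<close> step.hyps(1) le_SucI order_refl by metis
qed (use D in simp)

text \<open>One stage of the construction of a run: settle one promise if it is present and still
  open, then add one more moment so that the path grows strictly.\<close>

lemma path_realise:
  assumes r: "path r n"
  shows "\<exists>r' m. n < m \<and> path r' m \<and> (\<forall>i\<le>n. r' i = r i) \<and>
    (i \<le> n \<longrightarrow> Dia \<psi> \<in> label (r i) \<longrightarrow> (\<exists>j. i \<le> j \<and> j \<le> m \<and> \<psi> \<in> label (r' j)))"
proof -
  obtain q k where q: "n \<le> k" "path q k" "\<forall>i\<le>n. q i = r i"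
    "i \<le> n \<longrightarrow> Dia \<psi> \<in> label (r i) \<longrightarrow> (\<exists>j. i \<le> j \<and> j \<le> k \<and> \<psi> \<in> label (q j))"
  proof (cases "i \<le> n \<and> Dia \<psi> \<in> label (r i) \<and> Dia \<psi> \<in> label (r n)")
    case True
    with path_Dia[OF r] obtain q k
      where "n \<le> k" "path q k" "\<forall>i\<le>n. q i = r i" "\<psi> \<in> label (q k)" by blast
    with True that[of k q] show ?thesis by (meson le_trans order_refl)
  next
    case False
    with path_Dia_later[OF r, of i \<psi>] that[of n r] r show ?thesis by blast
  qed
  obtain r' where r': "path r' (Suc k)" "\<forall>i\<le>k. r' i = q i"
    using path_extend_one[OF q(2)] by blast
  have "i \<le> n \<longrightarrow> Dia \<psi> \<in> label (r i) \<longrightarrow> (\<exists>j. i \<le> j \<and> j \<le> Suc k \<and> \<psi> \<in> label (r' j))"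
    using q(4) r'(2) by (metis le_SucI)
  moreover have "\<forall>i\<le>n. r' i = r i" using q(1,3) r'(2) by simp
  ultimately show ?thesis using q(1) r'(1) le_imp_less_Suc by blast
qed

lemma run_through_path:
  assumes r: "path r n"
  shows "\<exists>s\<in>runs. \<forall>i\<le>n. s i = r i"
proof -
  \<comment> \<open>Stage \<open>k\<close> settles the promise coded by \<open>k\<close>, a pair of
    an index and a formula, so every possible promise gets its turn.\<close>
  let ?i = "\<lambda>k. fst (prod_decode k)" and ?\<psi> = "\<lambda>k. from_nat (snd (prod_decode k)) :: fm"
  let ?Q = "\<lambda>k (x :: (nat \<Rightarrow> moment) \<times> nat) y. snd x < snd y \<and> (\<forall>i\<le>snd x. fst y i = fst x i) \<and>
    (?i k \<le> snd x \<longrightarrow> Dia (?\<psi> k) \<in> label (fst x (?i k)) \<longrightarrow>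
      (\<exists>j. ?i k \<le> j \<and> j \<le> snd y \<and> ?\<psi> k \<in> label (fst y j)))"
  let ?P = "\<lambda>k (x :: (nat \<Rightarrow> moment) \<times> nat). path (fst x) (snd x) \<and> (k = 0 \<longrightarrow> x = (r, n))"
  have "\<exists>X. \<forall>k. ?P k (X k) \<and> ?Q k (X k) (X (Suc k))"
  proof (rule dependent_nat_choice)
    show "\<exists>x. ?P 0 x" using r by auto
    fix x and k :: nat assume "?P k x"
    then have x: "path (fst x) (snd x)" by blast
    from path_realise[OF x, of "?i k" "?\<psi> k"] obtain r' l where
      "path r' l" "?Q k x (r', l)" by auto
    then show "\<exists>y. ?P (Suc k) y \<and> ?Q k x y" by (intro exI[where x = "(r', l)"] conjI) simp_all
  qed
  then obtain X where X: "\<And>k. ?P k (X k)" "\<And>k. ?Q k (X k) (X (Suc k))" by blast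
  have X0: "X 0 = (r, n)" using X(1)[of 0] by simp
  have agree: "snd (X k) \<le> snd (X l) \<and> (\<forall>i\<le>snd (X k). fst (X l) i = fst (X k) i)" if "k \<le> l" for k l
    using that
  proof (induction rule: dec_induct)
    case (step l)
    then show ?case using X(2)[of l] by auto
  qed simp
  have long: "k \<le> snd (X k)" for k
  proof (induction k)
    case (Suc k)
    then show ?case using X(2)[of k] by linarith
  qed simp
  \<comment> \<open>The limit is taken diagonally: the \<open>i\<close>-th path has length at least
    \<open>i\<close>, and later paths never change it there.\<close>
  define s where "s = (\<lambda>i. fst (X i) i)"
  have s: "s i = fst (X k) i" if "i \<le> snd (X k)" for i k
    using that agree[of i k] agree[of k i] long[of i] by (cases "i \<le> k") (auto simp: s_def)
  have "s \<in> runs"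
    unfolding runs_def
  proof (intro CollectI conjI allI impI)
    fix i
    show "s i \<in> moments" using X(1)[of i] long[of i] by (auto simp: s_def path_def)
    have i: "i < snd (X (Suc i))" using long[of "Suc i"] by simp
    have "step (fst (X (Suc i)) i) (fst (X (Suc i)) (Suc i))"
      using X(1)[of "Suc i"] i by (auto simp: path_def)
    then show "step (s i) (s (Suc i))" using s[of i "Suc i"] s[of "Suc i" "Suc i"] i by simp
    fix \<psi> assume D: "Dia \<psi> \<in> label (s i)"
    \<comment> \<open>Since \<open_dummy> is avoided: \<open>i\<close> is at most its code
      \<open>k\<close>, and \<open>k\<close> is at most the length of the path at stage
      \<open>k\<close>, the index \<open>i\<close> is already present when its promise is
      treated.\<close>
    define k where "k = prod_encode (i, to_nat \<psi>)"
    have "i \<le> snd (X k)" using long[of k] le_prod_encode_1[of i "to_nat \<psi>"] by (simp add: k_def)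
    then obtain j where "i \<le> j" "j \<le> snd (X (Suc k))" "\<psi> \<in> label (fst (X (Suc k)) j)"
      using X(2)[of k] D s[of i k] by (auto simp: k_def)
    then show "\<exists>j\<ge>i. \<psi> \<in> label (s j)" using s[of j "Suc k"] by auto
  qed
  moreover have "\<forall>i\<le>n. s i = r i" using s[of _ 0] X0 by simp
  ultimately show ?thesis by blast
qed

lemma run_refuting:
  assumes "\<not> L \<phi>"
  shows "\<exists>r\<in>runs. \<phi> \<notin> label (r 0)"
proof -
  obtain G where G: "prime_theory G" "\<phi> \<notin> G" using assms L_iff_prime by blast
  obtain w where w: "moment_ok w" "sim w G" using moment_exists[OF G(1)] by blast
  then have "path (\<lambda>_. w) 0" by (auto simp: path_def moments_def)
  then obtain r where "r \<in> runs" "r 0 = w" using run_through_path by blast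
  then show ?thesis using simD(2)[OF w(2)] G(2) by auto
qed

section \<open>The dynamical system of runs\<close>

text \<open>The subspace topology from the product of the up-set topologies of \<open>below\<close>.
  Neighbourhoods constrain finitely many coordinates, so a path inside one can afterwards be
  continued freely to realise its own promises.\<close>

definition run_topology :: "(nat \<Rightarrow> moment) topology" where
  "run_topology = topology (\<lambda>U. U \<subseteq> runs \<and>
     (\<forall>r\<in>U. \<exists>n. \<forall>s\<in>runs. (\<forall>i\<le>n. below (r i) (s i)) \<longrightarrow> s \<in> U))"

lemma openin_run_topology:
  "openin run_topology U \<longleftrightarrow> U \<subseteq> runs \<and>
     (\<forall>r\<in>U. \<exists>n. \<forall>s\<in>runs. (\<forall>i\<le>n. below (r i) (s i)) \<longrightarrow> s \<in> U)"
proof -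
  let ?P = "\<lambda>U. U \<subseteq> runs \<and> (\<forall>r\<in>U. \<exists>n. \<forall>s\<in>runs. (\<forall>i\<le>n. below (r i) (s i)) \<longrightarrow> s \<in> U)"
  have "istopology ?P"
    unfolding istopology_def
  proof (intro conjI allI impI)
    fix U W assume U: "?P U" and W: "?P W"
    show "U \<inter> W \<subseteq> runs" using U by blast
    show "\<forall>r\<in>U \<inter> W. \<exists>n. \<forall>s\<in>runs. (\<forall>i\<le>n. below (r i) (s i)) \<longrightarrow> s \<in> U \<inter> W"
    proof
      fix r assume "r \<in> U \<inter> W"
      then obtain n m where n: "\<forall>s\<in>runs. (\<forall>i\<le>n. below (r i) (s i)) \<longrightarrow> s \<in> U"
        and m: "\<forall>s\<in>runs. (\<forall>i\<le>m. below (r i) (s i)) \<longrightarrow> s \<in> W"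
        using U W by (metis IntD1 IntD2)
      then show "\<exists>n. \<forall>s\<in>runs. (\<forall>i\<le>n. below (r i) (s i)) \<longrightarrow> s \<in> U \<inter> W"
        by (intro exI[of _ "max n m"]) simp
    qed
  next
    fix K assume K: "\<forall>U\<in>K. ?P U"
    then show "\<Union>K \<subseteq> runs" by blast
    show "\<forall>r\<in>\<Union>K. \<exists>n. \<forall>s\<in>runs. (\<forall>i\<le>n. below (r i) (s i)) \<longrightarrow> s \<in> \<Union>K"
    proof
      fix r assume "r \<in> \<Union>K"
      then obtain U where "U \<in> K" "r \<in> U" by blast
      then obtain n where "\<forall>s\<in>runs. (\<forall>i\<le>n. below (r i) (s i)) \<longrightarrow> s \<in> U" using K by blast
      then show "\<exists>n. \<forall>s\<in>runs. (\<forall>i\<le>n. below (r i) (s i)) \<longrightarrow> s \<in> \<Union>K" using \<open>U \<in> K\<close> by blast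
    qed
  qed
  then show ?thesis by (simp add: run_topology_def topology_inverse')
qed

lemma topspace_run_topology: "topspace run_topology = runs"
proof -
  have "openin run_topology runs" by (simp add: openin_run_topology)
  then have "runs \<subseteq> topspace run_topology" by (rule openin_subset)
  moreover have "topspace run_topology \<subseteq> runs"
    using openin_topspace[of run_topology] openin_run_topology by blast
  ultimately show ?thesis by blast
qed

definition shift :: "(nat \<Rightarrow> moment) \<Rightarrow> nat \<Rightarrow> moment" where
  "shift r = (\<lambda>i. r (Suc i))"

lemma shift_pow: "(shift ^^ n) r = (\<lambda>i. r (n + i))"
  by (induction n) (auto simp: shift_def)

lemma shift_runs: "r \<in> runs \<Longrightarrow> shift r \<in> runs"
  unfolding runs_def shift_def by clarsimp (metis Suc_le_D Suc_le_mono)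

lemma dyn_system_runs: "dyn_system run_topology shift"
  unfolding dyn_system_def continuous_map_def topspace_run_topology
proof (intro conjI allI impI)
  show "shift \<in> runs \<rightarrow> runs" using shift_runs by blast
  fix U assume U: "openin run_topology U"
  show "openin run_topology {r \<in> runs. shift r \<in> U}"
    unfolding openin_run_topology
  proof (intro conjI ballI)
    fix r assume "r \<in> {r \<in> runs. shift r \<in> U}"
    then obtain n where n: "\<forall>s\<in>runs. (\<forall>i\<le>n. below (shift r i) (s i)) \<longrightarrow> s \<in> U"
      using U by (auto simp: openin_run_topology)
    \<comment> \<open>One more coordinate has to be controlled, because coordinate \<open>i\<close>
      of \<open>shift r\<close> is coordinate \<open>Suc i\<close> of \<open>r\<close>.\<close>
    have "s \<in> {r \<in> runs. shift r \<in> U}" if "s \<in> runs" "\<forall>i\<le>Suc n. below (r i) (s i)" for s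
      using n shift_runs that by (auto simp: shift_def)
    then show "\<exists>n. \<forall>s\<in>runs. (\<forall>i\<le>n. below (r i) (s i)) \<longrightarrow> s \<in> {r \<in> runs. shift r \<in> U}" by blast
  qed auto
qed

section \<open>Truth lemma for runs\<close>

definition label_runs :: "fm \<Rightarrow> (nat \<Rightarrow> moment) set" where
  "label_runs \<phi> = {r \<in> runs. \<phi> \<in> label (r 0)}"

lemma runsD:
  assumes "r \<in> runs"
  shows "r i \<in> moments" and "step (r i) (r (Suc i))"
    and "Dia \<psi> \<in> label (r i) \<Longrightarrow> \<exists>j\<ge>i. \<psi> \<in> label (r j)"
  using assms by (auto simp: runs_def)

lemma run_label:
  assumes "r \<in> runs" obtains G where "prime_theory G" "label (r 0) = G \<inter> \<Sigma>"
  using moments_label runsD(1)[OF assms] by blast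

lemma openin_label_runs: "openin run_topology (label_runs \<phi>)"
  unfolding openin_run_topology
proof (intro conjI ballI)
  fix r assume "r \<in> label_runs \<phi>"
  then have r: "\<phi> \<in> label (r 0)" "r 0 \<in> moments" by (auto simp: label_runs_def runs_def)
  \<comment> \<open>Controlling coordinate 0 is enough, as labels grow along
    \<open>below\<close>.\<close>
  then have "\<forall>s\<in>runs. (\<forall>i\<le>0. below (r i) (s i)) \<longrightarrow> s \<in> label_runs \<phi>"
    using moments_below[OF r(2)] by (auto simp: label_runs_def)
  then show "\<exists>n. \<forall>s\<in>runs. (\<forall>i\<le>n. below (r i) (s i)) \<longrightarrow> s \<in> label_runs \<phi>" by blast
qed (auto simp: label_runs_def)

text \<open>Confluence of \<open>step\<close> lifts the run one coordinate at a time. Only finite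
  lifts are claimed, since nothing forces an infinite lift to realise its promises.\<close>

lemma path_above:
  assumes r: "r \<in> runs" and v: "below (r 0) v"
  shows "\<exists>q. q 0 = v \<and> path q n \<and> (\<forall>i\<le>n. below (r i) (q i))"
proof (induction n)
  case 0
  have "v \<in> moments" using moments_below[OF runsD(1)[OF r] v] by blast
  then show ?case using v by (intro exI[of _ "\<lambda>_. v"]) (auto simp: path_def)
next
  case (Suc n)
  then obtain q where q: "q 0 = v" "path q n" "\<forall>i\<le>n. below (r i) (q i)" by blast
  then obtain u where u: "below (r (Suc n)) u" "step (q n) u"
    using step_below[of "r n" "q n" "r (Suc n)"] runsD(2)[OF r] by blast
  have "u \<in> moments" using moments_below[OF runsD(1)[OF r] u(1)] by blast
  then show ?case
    using q u by (intro exI[of _ "q(Suc n := u)"]) (auto simp: path_def le_Suc_eq less_Suc_eq)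
qed

text \<open>One inclusion holds because the right side is open and labels respect modus ponens. For
  the other, a refuting node above the first moment is followed along the run for as long as the
  neighbourhood looks, and then completed to a run.\<close>

lemma label_runs_Imp:
  assumes S: "Imp \<phi> \<psi> \<in> \<Sigma>"
  shows "run_topology interior_of ((runs - label_runs \<phi>) \<union> label_runs \<psi>) = label_runs (Imp \<phi> \<psi>)"
proof
  have "label_runs (Imp \<phi> \<psi>) \<subseteq> (runs - label_runs \<phi>) \<union> label_runs \<psi>"
  proof
    fix r assume r: "r \<in> label_runs (Imp \<phi> \<psi>)"
    then obtain G where G: "prime_theory G" "label (r 0) = G \<inter> \<Sigma>"
      using run_label by (auto simp: label_runs_def)
    then show "r \<in> (runs - label_runs \<phi>) \<union> label_runs \<psi>"
      using r prime_mp[OF G(1), of \<phi> \<psi>] sub_Imp[OF S] by (auto simp: label_runs_def)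
  qed
  then show "label_runs (Imp \<phi> \<psi>) \<subseteq> run_topology interior_of ((runs - label_runs \<phi>) \<union> label_runs \<psi>)"
    using openin_label_runs by (rule interior_of_maximal)
next
  show "run_topology interior_of ((runs - label_runs \<phi>) \<union> label_runs \<psi>) \<subseteq> label_runs (Imp \<phi> \<psi>)"
  proof
    fix r assume "r \<in> run_topology interior_of ((runs - label_runs \<phi>) \<union> label_runs \<psi>)"
    then obtain U where U: "openin run_topology U" "r \<in> U" "U \<subseteq> (runs - label_runs \<phi>) \<union> label_runs \<psi>"
      by (auto simp: interior_of_def)
    then obtain n where n: "\<forall>s\<in>runs. (\<forall>i\<le>n. below (r i) (s i)) \<longrightarrow> s \<in> U"
      by (auto simp: openin_run_topology)
    have r: "r \<in> runs" using U by (auto simp: openin_run_topology)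
    show "r \<in> label_runs (Imp \<phi> \<psi>)"
    proof (rule ccontr)
      assume "\<not> ?thesis"
      then have "Imp \<phi> \<psi> \<in> \<Sigma> - label (r 0)" using r S by (auto simp: label_runs_def)
      then obtain v where v: "below (r 0) v" "\<phi> \<in> label v" "\<psi> \<notin> label v"
        using moments_Imp[OF runsD(1)[OF r]] by blast
      obtain q where q: "q 0 = v" "path q n" "\<forall>i\<le>n. below (r i) (q i)"
        using path_above[OF r v(1)] by blast
      obtain s where s: "s \<in> runs" "\<forall>i\<le>n. s i = q i"
        using run_through_path[OF q(2)] by blast
      then have "s \<in> U" using n q(3) by auto
      then show False using U(3) s q(1) v by (auto simp: label_runs_def)
    qed
  qed
qed

text \<open>Steps carry \<open>Dia \<phi>\<close> backwards from a moment containing \<phi>; the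
  converse is the realisation condition in \<open>runs\<close>.\<close>

lemma label_runs_Dia:
  assumes S: "Dia \<phi> \<in> \<Sigma>"
  shows "(\<Union>n. {r \<in> runs. (shift ^^ n) r \<in> label_runs \<phi>}) = label_runs (Dia \<phi>)"
proof -
  have backwards: "Dia \<phi> \<in> label (r 0)" if r: "r \<in> runs" and "Dia \<phi> \<in> label (r n)" for r n
    using that(2)
  proof (induction n)
    case (Suc n)
    then show ?case using step_label_Dia[OF runsD(2)[OF r] S] by blast
  qed
  have start: "Dia \<phi> \<in> label (r 0)" if "r \<in> runs" "\<phi> \<in> label (r n)" for r n
    using backwards[OF that(1)] step_label_Dia[OF runsD(2)[OF that(1)] S] that(2) by blast
  have "(shift ^^ n) r \<in> runs" if "r \<in> runs" for r n
    using that by (induction n) (auto intro: shift_runs)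
  then have "(\<Union>n. {r \<in> runs. (shift ^^ n) r \<in> label_runs \<phi>}) = {r \<in> runs. \<exists>n. \<phi> \<in> label (r n)}"
    by (auto simp: label_runs_def shift_pow)
  also have "\<dots> = label_runs (Dia \<phi>)"
    unfolding label_runs_def using start runsD(3) by blast
  finally show ?thesis .
qed

text \<open>By \<open>prime_Univ\<close> a label contains \<open>Univ \<phi>\<close> exactly when
  \<phi> is a theorem of the logic, and every nontheorem is missing from the first label of some
  run.\<close>

lemma label_runs_Univ:
  assumes S: "Univ \<phi> \<in> \<Sigma>"
  shows "label_runs (Univ \<phi>) = (if label_runs \<phi> = runs then runs else {})"
proof (cases "L \<phi>")
  case True
  have "\<phi> \<in> label (r 0) \<and> Univ \<phi> \<in> label (r 0)" if r: "r \<in> runs" for r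
  proof -
    obtain G where G: "prime_theory G" "label (r 0) = G \<inter> \<Sigma>" using run_label[OF r] .
    then show ?thesis using True prime_Univ[OF G(1)] prime_L[OF G(1)] S sub_Univ[OF S] by auto
  qed
  then show ?thesis by (auto simp: label_runs_def)
next
  case False
  have "Univ \<phi> \<notin> label (r 0)" if r: "r \<in> runs" for r
    using run_label[OF r] prime_Univ False by (metis IntD1)
  then have "label_runs (Univ \<phi>) = {}" by (auto simp: label_runs_def)
  moreover obtain r where "r \<in> runs" "\<phi> \<notin> label (r 0)"
    using run_refuting[OF False] by blast
  then have "label_runs \<phi> \<noteq> runs" by (auto simp: label_runs_def)
  ultimately show ?thesis by simp
qed

lemma sem_runs:
  "\<phi> \<in> \<Sigma> \<Longrightarrow> sem run_topology shift (\<lambda>p. label_runs (Var p)) \<phi> = label_runs \<phi>"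
proof (induction \<phi>)
  case Bot
  have "Bot \<notin> label (r 0)" if "r \<in> runs" for r
    using run_label[OF that] prime_Bot by (metis IntD1)
  then show ?case by (auto simp: label_runs_def)
next
  case (And \<phi> \<psi>)
  have "And \<phi> \<psi> \<in> label (r 0) \<longleftrightarrow> \<phi> \<in> label (r 0) \<and> \<psi> \<in> label (r 0)" if "r \<in> runs" for r
    using run_label[OF that] prime_And And.prems sub_And[OF And.prems] by (metis Int_iff)
  then show ?case using And sub_And[OF And.prems] by (auto simp: label_runs_def)
next
  case (Or \<phi> \<psi>)
  have "Or \<phi> \<psi> \<in> label (r 0) \<longleftrightarrow> \<phi> \<in> label (r 0) \<or> \<psi> \<in> label (r 0)" if "r \<in> runs" for r
    using run_label[OF that] prime_Or Or.prems sub_Or[OF Or.prems] by (metis Int_iff)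
  then show ?case using Or sub_Or[OF Or.prems] by (auto simp: label_runs_def)
next
  case (Imp \<phi> \<psi>)
  then show ?case
    using label_runs_Imp[OF Imp.prems] sub_Imp[OF Imp.prems] by (simp add: topspace_run_topology)
next
  case (Nxt \<phi>)
  have "Nxt \<phi> \<in> label (r 0) \<longleftrightarrow> \<phi> \<in> label (shift r 0)" if "r \<in> runs" for r
    using step_label_Nxt[OF runsD(2)[OF that] Nxt.prems] by (simp add: shift_def)
  then show ?case
    using Nxt sub_Nxt[OF Nxt.prems] shift_runs by (auto simp: label_runs_def topspace_run_topology)
next
  case (Dia \<phi>)
  then show ?case
    using label_runs_Dia[OF Dia.prems] sub_Dia[OF Dia.prems] by (simp add: topspace_run_topology)
next
  case (Univ \<phi>)
  then show ?case
    using label_runs_Univ[OF Univ.prems] sub_Univ[OF Univ.prems] by (simp add: topspace_run_topology)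
qed simp

section \<open>Carrier type and completeness\<close>

text \<open>Finitely many moments can be numbered, so a run is coded by the graph of a function on
  the naturals. Each coded pair is wrapped in a singleton to land in
  \<open>nat set set\<close>.\<close>

lemma runs_embed: "\<exists>e :: (nat \<Rightarrow> moment) \<Rightarrow> nat set set. inj_on e runs"
proof -
  obtain c :: "moment \<Rightarrow> nat" where c: "inj_on c moments"
    using finite_imp_inj_to_nat_seg[OF finite_realised_moments] by blast
  let ?e = "\<lambda>r. {{prod_encode (i, c (r i))} | i. True}"
  have "inj_on ?e runs"
  proof (rule inj_onI)
    fix r s assume r: "r \<in> runs" and s: "s \<in> runs" and eq: "?e r = ?e s"
    show "r = s"
    proof
      fix i
      have "{prod_encode (i, c (r i))} \<in> ?e s" unfolding eq[symmetric] by blast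
      then have "c (r i) = c (s i)" by auto
      then show "r i = s i" using c runsD(1)[OF r] runsD(1)[OF s] by (auto dest: inj_onD)
    qed
  qed
  then show ?thesis by blast
qed

lemma valid_imp_L:
  assumes valid: "valid_dyn TYPE(nat set set) \<phi>" and S: "\<phi> \<in> \<Sigma>"
  shows "L \<phi>"
proof (rule ccontr)
  assume "\<not> L \<phi>"
  then obtain r where r: "r \<in> runs" "\<phi> \<notin> label (r 0)" using run_refuting by blast
  obtain e :: "(nat \<Rightarrow> moment) \<Rightarrow> nat set set" where e: "inj_on e runs" using runs_embed by blast
  have "valuation run_topology (\<lambda>p. label_runs (Var p))"
    using openin_label_runs by (simp add: valuation_def)
  then have "label_runs \<phi> = runs"
    using valid_dyn_transfer[OF valid _ dyn_system_runs] e sem_runs[OF S]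
    by (metis topspace_run_topology)
  then show False using r by (auto simp: label_runs_def)
qed

end

fun subformulas :: "fm \<Rightarrow> fm set" where
  "subformulas Bot = {Bot}"
| "subformulas (Var p) = {Var p}"
| "subformulas (And \<phi> \<psi>) = insert (And \<phi> \<psi>) (subformulas \<phi> \<union> subformulas \<psi>)"
| "subformulas (Or \<phi> \<psi>) = insert (Or \<phi> \<psi>) (subformulas \<phi> \<union> subformulas \<psi>)"
| "subformulas (Imp \<phi> \<psi>) = insert (Imp \<phi> \<psi>) (subformulas \<phi> \<union> subformulas \<psi>)"
| "subformulas (Nxt \<phi>) = insert (Nxt \<phi>) (subformulas \<phi>)"
| "subformulas (Dia \<phi>) = insert (Dia \<phi>) (subformulas \<phi>)"
| "subformulas (Univ \<phi>) = insert (Univ \<phi>) (subformulas \<phi>)"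

lemma subformulas_refl: "\<phi> \<in> subformulas \<phi>"
  by (cases \<phi>) auto

lemma subformulas_trans: "\<psi> \<in> subformulas \<phi> \<Longrightarrow> subformulas \<psi> \<subseteq> subformulas \<phi>"
  by (induction \<phi>) auto

lemma finite_subformulas: "finite (subformulas \<phi>)"
  by (induction \<phi>) auto

text \<open>It suffices to find \<phi> in every prime theory \<open>G\<close>. The logic relativised
  to \<open>G\<close> proves \<phi>, since otherwise its runs, copied into
  \<open>nat set set\<close>, would refute \<phi>; hence \<open>Univ \<phi>\<close> is in
  \<open>G\<close>, and (UA4) gives \<phi>.\<close>

theorem theorem9p8:
  fixes \<phi> :: fm
  assumes "valid_dyn TYPE(nat set set) \<phi>"
  shows "ITL0 \<phi>"
proof (rule ITL0.L_iff_prime[THEN iffD2], intro allI impI)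
  fix G assume G: "ITL0.prime_theory G"
  interpret universal_temporal_logic "\<lambda>\<phi>. Univ \<phi> \<in> G"
    by (rule relativised_logic[OF G])
  have sub: "\<psi> \<in> subformulas \<phi>" if "\<chi> \<in> subformulas \<phi>" "\<psi> \<in> subformulas \<chi>" for \<psi> \<chi>
    using subformulas_trans that by blast
  interpret filtration "\<lambda>\<phi>. Univ \<phi> \<in> G" "subformulas \<phi>"
    by unfold_locales (auto simp: finite_subformulas subformulas_refl elim!: sub)
  have "Univ \<phi> \<in> G" by (rule valid_imp_L[OF assms subformulas_refl])
  then show "\<phi> \<in> G" by (rule ITL0.prime_L_mp[OF G ITL0.UA4])
qed

end
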